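(* Consider the two-person game model with finite state space $E$ and finite action spaces described in the context. Let $$\gamma:=\min_{(i,j)\in E^2}\inf_{\pi\in\Pi_1}\inf_{\sigma\in\Pi_2}\mathbb{P}_i^{\pi,\sigma}(\tau_j\le|E|),$$ where $\tau_j:=\inf\{n>0\mid X_n=j\}$ (with $\inf\emptyset:=+\infty$) and $|E|$ is the cardinality of $E$. (a) For each $i,j\in E$ define $$V_0^j(i):=1\quad\text{and}\quad V_{k+1}^j(i):=\max_{a\in A(i)}\max_{b\in B(i)}\sum_{i_1\in E,\,i_1\ne j}P(i_1|i,a,b)V_k^j(i_1),\quad k\in\mathbb{N}.$$ Then $\gamma=1-\max_{(i,j)\in E^2}V_{|E|}^j(i)$. (b) The irreducibility condition (for every pair of deterministic stationary policies $(f,g)\in\Pi_1^{sd}\times\Pi_2^{sd}$, the Markov chain $\{X_n,n\in\mathbb{N}\}$ is irreducible under $(f,g)$) holds if and only if $\gamma>0$.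
   Context: Model: $E$ (states), $A$, $B$ (actions of players 1 and 2) are finite nonempty sets; for each $i\in E$, $A(i)\subset A$ and $B(i)\subset B$ are the nonempty sets of admissible actions; $\mathbb{K}:=\{(i,a,b): i\in E,a\in A(i),b\in B(i)\}$; $P(\cdot|i,a,b)$ is a probability distribution on $E$ for each $(i,a,b)\in\mathbb{K}$. $\mathbb{N}=\{0,1,2,\ldots\}$. Policies: Let $H_0=E$, $H_n=\mathbb{K}^n\times E$ for $n\ge1$. A (randomized history-dependent) policy of player 1 is a sequence $\pi=\{\pi_n,n\in\mathbb{N}\}$ of stochastic kernels $\pi_n$ on $A$ given $H_n$ with $\pi_n(A(i_n)|h_n)=1$ for all $h_n=(i_0,a_0,b_0,\ldots,i_{n-1},a_{n-1},b_{n-1},i_n)\in H_n$. It is deterministic stationary if there is a map $f:E\to A$ with $\pi_n(\cdot|h_n)=\delta_{f(i_n)}$ for all $n,h_n$ (then $\pi$ is written $f$). $\Pi_1$ and $\Pi_1^{sd}$ are the sets of all policies and of all deterministic stationary policies of player 1; $\Pi_2,\Pi_2^{sd}$ are defined analogously for player 2 with $B,B(i)$. For $i\in E$, $(\pi,\sigma)\in\Pi_1\times\Pi_2$, $\mathbb{P}_i^{\pi,\sigma}$ is the unique probability measure on $(E\times A\times B)^\infty$ with coordinate processes $X_n,A_n,B_n$ such that $X_0=i$ a.s.; given the history $h_n$ up to time $n$, $A_n$ and $B_n$ are independent with laws $\pi_n(\cdot|h_n)$, $\sigma_n(\cdot|h_n)$; and given $h_n,a_n,b_n$, $X_{n+1}$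 has law $P(\cdot|i_n,a_n,b_n)$. Irreducible under $(f,g)$ means: for all $i,j\in E$ there is $n\ge1$ with $\mathbb{P}_i^{f,g}(X_n=j)>0$. *)

theory Defs
  imports "HOL-Probability.Probability" "HOL-Library.Extended_Nat"
begin

text \<open>
  The state space and the two action spaces are finite types \<open>'e\<close>, \<open>'a\<close>, \<open>'b\<close> (types are never
  empty).  A model is given by the admissible-action maps \<open>A\<close>, \<open>B\<close> and the transition law \<open>P\<close>;
  all three are passed explicitly.  \<open>P i a b\<close> is a probability distribution for all arguments, but
  its values at inadmissible action pairs carry no meaning.
\<close>

definition admissible :: "('e \<Rightarrow> 'a set) \<Rightarrow> ('e \<Rightarrow> 'b set) \<Rightarrow> ('e \<times> 'a \<times> 'b) set" where
  "admissible A B = {(i, a, b). a \<in> A i \<and> b \<in> B i}"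

text \<open>
  The history \<open>(i\<^sub>0, a\<^sub>0, b\<^sub>0, \<dots>, i\<^sub>n\<^sub>-\<^sub>1, a\<^sub>n\<^sub>-\<^sub>1, b\<^sub>n\<^sub>-\<^sub>1, i\<^sub>n)\<close> is the pair of the list of the \<open>n\<close> past
  triples (oldest first) and the current state \<open>i\<^sub>n\<close>.
\<close>

type_synonym ('e, 'a, 'b) history = "('e \<times> 'a \<times> 'b) list \<times> 'e"

definition histories ::
    "('e \<Rightarrow> 'a set) \<Rightarrow> ('e \<Rightarrow> 'b set) \<Rightarrow> nat \<Rightarrow> ('e, 'a, 'b) history set" where
  "histories A B n = {(l, i). length l = n \<and> set l \<subseteq> admissible A B}"

text \<open>
  Policies of either player: \<open>C\<close> is the admissible-action map of the player concerned, so that the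
  policy sets of players 1 and 2 are \<open>policies A B A\<close> and \<open>policies A B B\<close>.  As all spaces are
  finite, a stochastic kernel is a map into \<open>pmf\<close>.  The values of a policy outside
  \<open>histories A B n\<close> are unconstrained and irrelevant.
\<close>

definition policies ::
    "('e \<Rightarrow> 'a set) \<Rightarrow> ('e \<Rightarrow> 'b set) \<Rightarrow> ('e \<Rightarrow> 'c set)
      \<Rightarrow> (nat \<Rightarrow> ('e, 'a, 'b) history \<Rightarrow> 'c pmf) set" where
  "policies A B C =
    {\<pi>. \<forall>n. \<forall>h \<in> histories A B n. measure_pmf.prob (\<pi> n h) (C (snd h)) = 1}"

definition stationary_policies ::
    "('e \<Rightarrow> 'a set) \<Rightarrow> ('e \<Rightarrow> 'b set) \<Rightarrow> ('e \<Rightarrow> 'c set)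
      \<Rightarrow> (nat \<Rightarrow> ('e, 'a, 'b) history \<Rightarrow> 'c pmf) set" where
  "stationary_policies A B C =
    {\<pi> \<in> policies A B C.
      \<exists>f. \<forall>n. \<forall>h \<in> histories A B n. \<pi> n h = return_pmf (f (snd h))}"

text \<open>Coordinate processes on the space of trajectories \<open>nat \<Rightarrow> 'e \<times> 'a \<times> 'b\<close>.\<close>

definition state_at :: "nat \<Rightarrow> (nat \<Rightarrow> 'e \<times> 'a \<times> 'b) \<Rightarrow> 'e" where
  "state_at n \<omega> = fst (\<omega> n)"

definition act1_at :: "nat \<Rightarrow> (nat \<Rightarrow> 'e \<times> 'a \<times> 'b) \<Rightarrow> 'a" where
  "act1_at n \<omega> = fst (snd (\<omega> n))"

definition act2_at :: "nat \<Rightarrow> (nat \<Rightarrow> 'e \<times> 'a \<times> 'b) \<Rightarrow> 'b" where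
  "act2_at n \<omega> = snd (snd (\<omega> n))"

definition hist_at :: "nat \<Rightarrow> (nat \<Rightarrow> 'e \<times> 'a \<times> 'b) \<Rightarrow> ('e, 'a, 'b) history" where
  "hist_at n \<omega> = (map \<omega> [0..<n], state_at n \<omega>)"

text \<open>
  The conditional laws given the history are written in multiplied-out form, so that histories of
  probability zero need no separate treatment.
\<close>

definition is_game_measure ::
    "('e \<Rightarrow> 'a \<Rightarrow> 'b \<Rightarrow> 'e pmf) \<Rightarrow> 'e
      \<Rightarrow> (nat \<Rightarrow> ('e, 'a, 'b) history \<Rightarrow> 'a pmf) \<Rightarrow> (nat \<Rightarrow> ('e, 'a, 'b) history \<Rightarrow> 'b pmf)
      \<Rightarrow> (nat \<Rightarrow> 'e \<times> 'a \<times> 'b) measure \<Rightarrow> bool" where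
  "is_game_measure P i \<pi> \<sigma> M \<longleftrightarrow>
    prob_space M \<and>
    sets M = sets (\<Pi>\<^sub>M n \<in> UNIV. count_space UNIV) \<and>
    (AE \<omega> in M. state_at 0 \<omega> = i) \<and>
    (\<forall>n h a b.
      \<P>(\<omega> in M. hist_at n \<omega> = h \<and> act1_at n \<omega> = a \<and> act2_at n \<omega> = b)
        = \<P>(\<omega> in M. hist_at n \<omega> = h) * (pmf (\<pi> n h) a * pmf (\<sigma> n h) b)) \<and>
    (\<forall>n h a b j.
      \<P>(\<omega> in M. hist_at n \<omega> = h \<and> act1_at n \<omega> = a \<and> act2_at n \<omega> = b \<and> state_at (Suc n) \<omega> = j)
        = \<P>(\<omega> in M. hist_at n \<omega> = h \<and> act1_at n \<omega> = a \<and> act2_at n \<omega> = b)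
            * pmf (P (snd h) a b) j)"

definition game_measure ::
    "('e \<Rightarrow> 'a \<Rightarrow> 'b \<Rightarrow> 'e pmf) \<Rightarrow> 'e
      \<Rightarrow> (nat \<Rightarrow> ('e, 'a, 'b) history \<Rightarrow> 'a pmf) \<Rightarrow> (nat \<Rightarrow> ('e, 'a, 'b) history \<Rightarrow> 'b pmf)
      \<Rightarrow> (nat \<Rightarrow> 'e \<times> 'a \<times> 'b) measure" where
  "game_measure P i \<pi> \<sigma> = (THE M. is_game_measure P i \<pi> \<sigma> M)"

text \<open>
  The description of the law of the process above determines it uniquely, so the definite
  description in \<open>game_measure\<close> is meaningful: \<open>is_game_measure_game_measure\<close> at the end of this
  group of lemmas.
\<close>

lemma space_traj: "sets M = sets (\<Pi>\<^sub>M n \<in> UNIV. count_space UNIV) \<Longrightarrow> space M = UNIV"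
  by (drule sets_eq_imp_space_eq) (simp add: space_PiM)

lemma sets_cylinder:
  fixes M :: "(nat \<Rightarrow> 's::finite) measure"
  assumes "sets M = sets (\<Pi>\<^sub>M n \<in> UNIV. count_space UNIV)"
  shows "{\<omega>. Q (map \<omega> [0..<n])} \<in> sets M"
proof -
  have c: "(\<lambda>\<omega>. \<omega> k) \<in> M \<rightarrow>\<^sub>M count_space UNIV" for k
    unfolding measurable_cong_sets[OF assms refl] by (rule measurable_component_singleton) simp
  have "{\<omega>. map \<omega> [0..<n] = l} \<in> sets M" for l
  proof (cases "length l = n")
    case True
    then have "{\<omega>. map \<omega> [0..<n] = l} = (\<Inter>k\<in>{..<n}. (\<lambda>\<omega>. \<omega> k) -` {l ! k} \<inter> space M) \<inter> space M"
      using space_traj[OF assms] by (auto simp: list_eq_iff_nth_eq)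
    also have "\<dots> \<in> sets M"
    proof (cases "n = 0")
      case False
      then have "(\<Inter>k\<in>{..<n}. (\<lambda>\<omega>. \<omega> k) -` {l ! k} \<inter> space M) \<in> sets M"
        by (intro sets.finite_INT measurable_sets[OF c]) auto
      then show ?thesis by (rule sets.Int) simp
    qed simp
    finally show ?thesis .
  next
    case False
    then have "{\<omega>. map \<omega> [0..<n] = l} = {}" by auto
    then show ?thesis by simp
  qed
  then have "(\<Union>l\<in>{l. set l \<subseteq> UNIV \<and> length l = n \<and> Q l}. {\<omega>. map \<omega> [0..<n] = l}) \<in> sets M"
    by (intro sets.finite_UN) (auto intro: finite_subset[OF _ finite_lists_length_eq[of UNIV n]])
  also have "(\<Union>l\<in>{l. set l \<subseteq> UNIV \<and> length l = n \<and> Q l}. {\<omega>. map \<omega> [0..<n] = l}) = {\<omega>. Q (map \<omega> [0..<n])}"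
    by auto
  finally show ?thesis .
qed

lemma measure_cylinder_sum:
  fixes M :: "(nat \<Rightarrow> 's::finite) measure"
  assumes "prob_space M" and S: "sets M = sets (\<Pi>\<^sub>M n \<in> UNIV. count_space UNIV)"
  shows "measure M {\<omega>. Q (map \<omega> [0..<n])}
    = (\<Sum>l | length l = n \<and> Q l. measure M {\<omega>. map \<omega> [0..<n] = l})"
proof -
  interpret prob_space M by fact
  have "measure M (\<Union>l\<in>{l. length l = n \<and> Q l}. {\<omega>. map \<omega> [0..<n] = l})
    = (\<Sum>l | length l = n \<and> Q l. measure M {\<omega>. map \<omega> [0..<n] = l})"
    using finite_lists_length_eq[of "UNIV::'s set" n]
    by (intro finite_measure_finite_Union)
       (auto simp: disjoint_family_on_def intro: sets_cylinder[OF S] elim: rev_finite_subset)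
  also have "(\<Union>l\<in>{l. length l = n \<and> Q l}. {\<omega>. map \<omega> [0..<n] = l}) = {\<omega>. Q (map \<omega> [0..<n])}"
    by auto
  finally show ?thesis .
qed

lemma trajectory_measure_eqI:
  fixes M N :: "(nat \<Rightarrow> 's::finite) measure"
  assumes pM: "prob_space M" and M: "sets M = sets (\<Pi>\<^sub>M n \<in> UNIV. count_space UNIV)"
    and pN: "prob_space N" and N: "sets N = sets (\<Pi>\<^sub>M n \<in> UNIV. count_space UNIV)"
    and eq: "\<And>n l. measure M {\<omega>. map \<omega> [0..<n] = l} = measure N {\<omega>. map \<omega> [0..<n] = l}"
  shows "M = N"
proof (rule measure_eqI_PiM_infinite[OF M N])
  interpret M: prob_space M by fact
  interpret N: prob_space N by fact
  show "finite_measure M" by unfold_locales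
  fix A and J :: "nat set" assume J: "finite J"
  then obtain n where n: "\<forall>k\<in>J. k < n" using finite_nat_set_iff_bounded by blast
  have E: "prod_emb UNIV (\<lambda>_. count_space UNIV) J (Pi\<^sub>E J A)
      = {\<omega>::nat \<Rightarrow> 's. (\<lambda>l. \<forall>k\<in>J. l ! k \<in> A k) (map \<omega> [0..<n])}"
    using n by (auto simp: prod_emb_def space_PiM PiE_iff)
  show "emeasure M (prod_emb UNIV (\<lambda>_. count_space UNIV) J (Pi\<^sub>E J A))
      = emeasure N (prod_emb UNIV (\<lambda>_. count_space UNIV) J (Pi\<^sub>E J A))"
    unfolding E M.emeasure_eq_measure N.emeasure_eq_measure
      measure_cylinder_sum[OF pM M, where Q="\<lambda>l. \<forall>k\<in>J. l ! k \<in> A k"]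
      measure_cylinder_sum[OF pN N, where Q="\<lambda>l. \<forall>k\<in>J. l ! k \<in> A k"] eq ..
qed

lemma map_upt_Suc_eq:
  "map \<omega> [0..<Suc n] = l @ [(x, a, b)] \<longleftrightarrow>
    hist_at n \<omega> = (l, x) \<and> act1_at n \<omega> = a \<and> act2_at n \<omega> = b"
  by (auto simp: hist_at_def state_at_def act1_at_def act2_at_def prod_eq_iff)

lemma hist_at_Suc_eq:
  "hist_at (Suc n) \<omega> = (l @ [(x, a, b)], j) \<longleftrightarrow>
    hist_at n \<omega> = (l, x) \<and> act1_at n \<omega> = a \<and> act2_at n \<omega> = b \<and> state_at (Suc n) \<omega> = j"
  by (auto simp: hist_at_def state_at_def act1_at_def act2_at_def prod_eq_iff)

lemma hist_at_0_eq: "hist_at 0 \<omega> = h \<longleftrightarrow> fst h = [] \<and> state_at 0 \<omega> = snd h"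
  by (auto simp: hist_at_def prod_eq_iff)

lemma game_measure_unique:
  fixes P :: "'e::finite \<Rightarrow> 'a::finite \<Rightarrow> 'b::finite \<Rightarrow> 'e pmf"
  assumes M: "is_game_measure P i \<pi> \<sigma> M" and N: "is_game_measure P i \<pi> \<sigma> N"
  shows "M = N"
proof -
  note d = is_game_measure_def
  have s: "space M = UNIV" using M space_traj[of M] by (simp add: d)
  have s': "space N = UNIV" using N space_traj[of N] by (simp add: d)
  have hist: "measure M {\<omega>. hist_at n \<omega> = h} = measure N {\<omega>. hist_at n \<omega> = h}" for n h
  proof (induction n arbitrary: h)
    case 0
    have "measure K {\<omega>. hist_at 0 \<omega> = h} = (if h = ([], i) then 1 else 0)"
      if "is_game_measure P i \<pi> \<sigma> K" for K
    proof -
      interpret prob_space K using that by (simp add: d)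
      have "space K = UNIV" using that space_traj[of K] by (simp add: d)
      moreover have "AE \<omega> in K. state_at 0 \<omega> = i" using that by (simp add: d)
      moreover have "{\<omega>. hist_at 0 \<omega> = h} \<in> sets K"
        using sets_cylinder[of K "\<lambda>l. fst h = [] \<and> fst (hd l) = snd h" "Suc 0"] that
        by (simp add: hist_at_0_eq state_at_def d)
      moreover have "hist_at 0 \<omega> = h \<longleftrightarrow> h = ([], state_at 0 \<omega>)" for \<omega>
        by (auto simp: hist_at_def)
      ultimately show ?thesis
        using prob_eq_1[of "{\<omega>. hist_at 0 \<omega> = h}"] prob_eq_0[of "{\<omega>. hist_at 0 \<omega> = h}"]
        by (cases "h = ([], i)") (auto simp: eq_commute[of i] elim!: eventually_mono)
    qed
    then show ?case using M N by simp
  next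
    case (Suc n)
    obtain l' j where h: "h = (l', j)" by (cases h)
    show ?case
    proof (cases l' rule: rev_cases)
      case Nil
      then have "{\<omega>. hist_at (Suc n) \<omega> = h} = {}" by (auto simp: h hist_at_def)
      then show ?thesis by simp
    next
      case (snoc l y)
      obtain x a b where "y = (x, a, b)" by (cases y)
      then have "\<And>\<omega>. hist_at (Suc n) \<omega> = h \<longleftrightarrow> hist_at n \<omega> = (l, x) \<and> act1_at n \<omega> = a
          \<and> act2_at n \<omega> = b \<and> state_at (Suc n) \<omega> = j"
        using snoc h hist_at_Suc_eq by metis
      then show ?thesis using M N Suc.IH[of "(l, x)"] s s' by (simp add: d)
    qed
  qed
  show ?thesis
  proof (rule trajectory_measure_eqI)
    show "measure M {\<omega>. map \<omega> [0..<n] = l'} = measure N {\<omega>. map \<omega> [0..<n] = l'}" for n l'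
    proof (cases "length l' = n")
      case False
      then have "{\<omega>. map \<omega> [0..<n] = l'} = {}" by auto
      then show ?thesis by simp
    next
      case l: True
      show ?thesis
      proof (cases l' rule: rev_cases)
        case Nil
        then have "{\<omega>. map \<omega> [0..<n] = l'} = (UNIV :: (nat \<Rightarrow> 'e \<times> 'a \<times> 'b) set)" using l by simp
        moreover have "measure M (space M) = 1" "measure N (space N) = 1"
          using M N by (auto simp: d intro: prob_space.prob_space)
        ultimately show ?thesis by (simp add: s s')
      next
        case (snoc l y)
        obtain x a b where "y = (x, a, b)" by (cases y)
        moreover obtain m where "n = Suc m" using snoc l by (cases n) auto
        ultimately have "\<And>\<omega>. map \<omega> [0..<n] = l' \<longleftrightarrow>
            hist_at m \<omega> = (l, x) \<and> act1_at m \<omega> = a \<and> act2_at m \<omega> = b"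
          using snoc map_upt_Suc_eq by metis
        then show ?thesis using M N hist s s' by (simp add: d)
      qed
    qed
  qed (use M N in \<open>auto simp: d\<close>)
qed


lemma game_measure_exists:
  fixes P :: "'e::finite \<Rightarrow> 'a::finite \<Rightarrow> 'b::finite \<Rightarrow> 'e pmf"
  shows "\<exists>M. is_game_measure P i \<pi> \<sigma> M"
proof -
  define t where "t l = (if l = [] then return_pmf i else case last l of (x, a, b) \<Rightarrow> P x a b)" for l
  define \<kappa> where "\<kappa> l = bind_pmf (t l) (\<lambda>x. map_pmf (Pair x)
      (pair_pmf (\<pi> (length l) (l, x)) (\<sigma> (length l) (l, x))))" for l
  have \<kappa>: "pmf (\<kappa> l) (x, a, b) = pmf (t l) x * (pmf (\<pi> (length l) (l, x)) a * pmf (\<sigma> (length l) (l, x)) b)"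
    for l x a b
  proof -
    have "pmf (map_pmf (Pair y) Q) (x, z) = (if y = x then pmf Q z else 0)" for y z
      and Q :: "('a \<times> 'b) pmf"
    proof (cases "y = x")
      case True
      then show ?thesis by (simp add: pmf_map_inj' inj_on_def)
    next
      case False
      then show ?thesis by (auto simp: pmf_eq_0_set_pmf)
    qed
    note pair = this
    show ?thesis
      by (simp add: \<kappa>_def pmf_bind integral_measure_pmf[of UNIV] pair pmf_pair if_distrib sum.delta cong: if_cong)
  qed
  have prod_space: "PiM {0..<n} (\<lambda>_. count_space (UNIV :: ('e \<times> 'a \<times> 'b) set))
      = count_space (PiE {0..<n} (\<lambda>_. UNIV))" for n :: nat
    by (intro count_space_PiM_finite) auto
  interpret IT: Ionescu_Tulcea "\<lambda>n \<omega>. measure_pmf (\<kappa> (map \<omega> [0..<n]))" "\<lambda>_. count_space UNIV"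
  proof
    show "(\<lambda>\<omega>. measure_pmf (\<kappa> (map \<omega> [0..<n])))
        \<in> PiM {0..<n} (\<lambda>_. count_space UNIV) \<rightarrow>\<^sub>M subprob_algebra (count_space UNIV)" for n
      unfolding prod_space by (auto simp: measure_pmf_in_subprob_algebra)
  qed
  define q where "q n w = (\<Prod>k<n. pmf (\<kappa> (map w [0..<k])) (w k))" for n w
  have C: "emeasure (IT.C 0 n (\<lambda>_. undefined)) {restrict w {0..<n}} = ennreal (q n w)" for n w
  proof (induction n)
    case 0
    have "restrict w {0..<0} = (\<lambda>_. undefined)" by auto
    then show ?case by (simp add: q_def PiM_empty del: restrict_apply)
  next
    case (Suc n)
    let ?r = "restrict w {0..<Suc n}" and ?c = "IT.C 0 n (\<lambda>_. undefined)"
    have sp: "space ?c = PiE {0..<n} (\<lambda>_. UNIV)" "sets ?c = sets (count_space (PiE {0..<n} (\<lambda>_. UNIV)))"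
      using IT.space_C[of "\<lambda>_. undefined" 0 n] IT.sets_C[of "\<lambda>_. undefined" 0 n]
      by (simp_all add: space_PiM prod_space)
    have r: "{?r} \<in> sets (PiM {0..<Suc n} (\<lambda>_. count_space UNIV))"
      unfolding prod_space by auto
    have *: "emeasure (IT.eP n x) {?r}
        = ennreal (pmf (\<kappa> (map w [0..<n])) (w n)) * indicator {restrict w {0..<n}} x"
      if x: "x \<in> space ?c" for x
    proof -
      have "emeasure (IT.eP n x) {?r}
          = emeasure (measure_pmf (\<kappa> (map x [0..<n]))) {y. x(n := y) = ?r}"
        using x r by (subst IT.emeasure_eP) (auto simp: sp space_PiM vimage_def)
      also have "{y. x(n := y) = ?r} = (if x = restrict w {0..<n} then {w n} else {})"
      proof -
        have "x(n := y) = ?r \<longleftrightarrow> x = restrict w {0..<n} \<and> y = w n" for y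
          using x by (auto simp: sp fun_eq_iff PiE_iff extensional_def less_Suc_eq)
        then show ?thesis by auto
      qed
      finally have e: "emeasure (IT.eP n x) {?r} = emeasure (measure_pmf (\<kappa> (map x [0..<n])))
          (if x = restrict w {0..<n} then {w n} else {})" .
      show ?thesis
      proof (cases "x = restrict w {0..<n}")
        case True
        then have m: "map x [0..<n] = map w [0..<n]" by simp
        have "indicator {restrict w {0..<n}} x = (1 :: ennreal)" using True by simp
        then show ?thesis
          unfolding e if_P[OF True] m by (simp add: emeasure_pmf_single del: restrict_apply)
      qed (simp add: e del: restrict_apply)
    qed
    have "emeasure (IT.C 0 (Suc n) (\<lambda>_. undefined)) {?r} = (\<integral>\<^sup>+x. emeasure (IT.eP n x) {?r} \<partial>?c)"
      using IT.measurable_eP[of n] r sp(1)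
      by (simp, subst emeasure_bind[where N="PiM {0..<Suc n} (\<lambda>_. count_space UNIV)"])
         (auto simp: measurable_cong_sets[OF IT.sets_C[of "\<lambda>_. undefined" 0 n, simplified] refl] space_PiM PiE_eq_empty_iff)
    also have "\<dots> = (\<integral>\<^sup>+x. ennreal (pmf (\<kappa> (map w [0..<n])) (w n)) * indicator {restrict w {0..<n}} x \<partial>?c)"
      by (intro nn_integral_cong *)
    also have "\<dots> = ennreal (pmf (\<kappa> (map w [0..<n])) (w n)) * ennreal (q n w)"
      by (subst nn_integral_cmult_indicator) (auto simp: sp Suc.IH)
    also have "\<dots> = ennreal (q (Suc n) w)"
      by (simp add: q_def ennreal_mult prod_nonneg mult.commute)
    finally show ?case .
  qed
  define M where "M = IT.PF.lim"
  have M: "sets M = sets (\<Pi>\<^sub>M n \<in> UNIV. count_space UNIV)" by (simp add: M_def)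
  have cyl: "emeasure M {\<omega>. map \<omega> [0..<n] = map w [0..<n]} = ennreal (q n w)" for n w
  proof -
    let ?X = "{restrict w {0..<n}}"
    have X: "?X \<in> sets (PiM {0..<n} (\<lambda>_. count_space UNIV))"
      unfolding prod_space by auto
    have "prod_emb UNIV (\<lambda>_. count_space UNIV) {0..<n} ?X = {\<omega>. map \<omega> [0..<n] = map w [0..<n]}"
      by (auto simp: prod_emb_def space_PiM fun_eq_iff restrict_def) metis
    moreover have "prod_emb {0..<n} (\<lambda>_. count_space UNIV) {0..<n} ?X = ?X"
      by (auto simp: prod_emb_def space_PiM)
    ultimately show ?thesis
      using IT.lim[OF _ X] IT.emeasure_CI[OF subset_refl X] C[of n w] by (simp add: M_def)
  qed
  have sM: "space M = UNIV" by (rule space_traj[OF M])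
  have pM: "prob_space M"
    using cyl[of 0] by (intro prob_spaceI) (simp add: q_def sM)
  interpret prob_space M by fact
  have mcyl: "measure M {\<omega>. map \<omega> [0..<n] = map w [0..<n]} = q n w" for n w
    using cyl[of n w] by (simp add: measure_def q_def prod_nonneg)
  have step: "measure M {\<omega>. map \<omega> [0..<Suc (length l)] = l @ [y]}
      = measure M {\<omega>. map \<omega> [0..<length l] = l} * pmf (\<kappa> l) y" for l y
  proof -
    define w where "w k = (l @ [y]) ! k" for k
    have w: "w (length l) = y" "map w [0..<length l] = l"
      by (auto simp: w_def nth_append intro: nth_equalityI)
    then have "map w [0..<Suc (length l)] = l @ [y]" by simp
    then have "measure M {\<omega>. map \<omega> [0..<Suc (length l)] = l @ [y]} = q (Suc (length l)) w"
      using mcyl[of "Suc (length l)" w] by (simp only:)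
    moreover have "measure M {\<omega>. map \<omega> [0..<length l] = l} = q (length l) w"
      using mcyl[of "length l" w] by (simp only: w)
    ultimately show ?thesis by (simp only: q_def prod.lessThan_Suc w)
  qed
  have full: "measure M {\<omega>. hist_at (length l) \<omega> = (l, x) \<and> act1_at (length l) \<omega> = a \<and> act2_at (length l) \<omega> = b}
      = measure M {\<omega>. map \<omega> [0..<length l] = l} * pmf (\<kappa> l) (x, a, b)" for l x a b
    using step[of l "(x, a, b)"] unfolding map_upt_Suc_eq .
  have hist: "measure M {\<omega>. hist_at (length l) \<omega> = (l, x)}
      = measure M {\<omega>. map \<omega> [0..<length l] = l} * pmf (t l) x" for l x
  proof -
    have "{\<omega>. hist_at (length l) \<omega> = (l, x)} = (\<Union>(a, b). {\<omega>. map \<omega> [0..<Suc (length l)] = l @ [(x, a, b)]})"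
      unfolding map_upt_Suc_eq by auto
    also have "measure M \<dots> = (\<Sum>(a, b)\<in>UNIV. measure M {\<omega>. map \<omega> [0..<Suc (length l)] = l @ [(x, a, b)]})"
      unfolding split_def
      by (intro finite_measure_finite_Union)
         (auto simp: disjoint_family_on_def simp del: upt_Suc intro!: sets_cylinder[OF M])
    also have "\<dots> = (\<Sum>(a, b)\<in>UNIV. measure M {\<omega>. map \<omega> [0..<length l] = l} * pmf (t l) x
        * (pmf (\<pi> (length l) (l, x)) a * pmf (\<sigma> (length l) (l, x)) b))"
      unfolding step \<kappa> by (simp add: mult.assoc)
    also have "\<dots> = measure M {\<omega>. map \<omega> [0..<length l] = l} * pmf (t l) x
        * ((\<Sum>a\<in>UNIV. pmf (\<pi> (length l) (l, x)) a) * (\<Sum>b\<in>UNIV. pmf (\<sigma> (length l) (l, x)) b))"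
      unfolding sum_product unfolding sum.cartesian_product UNIV_Times_UNIV
      unfolding sum_distrib_left
      by (simp add: split_def)
    finally show ?thesis by (simp add: sum_pmf_eq_1)
  qed
  have "is_game_measure P i \<pi> \<sigma> M"
    unfolding is_game_measure_def sM
  proof (intro conjI allI)
    have "{\<omega>. state_at 0 \<omega> = i} \<in> sets M"
      using sets_cylinder[OF M, of "\<lambda>l. fst (hd l) = i" "Suc 0"] by (simp add: state_at_def)
    moreover have "measure M {\<omega>. state_at 0 \<omega> = i} = 1"
      using hist[of "[]" i] prob_space by (simp add: t_def hist_at_0_eq sM)
    ultimately show "AE \<omega> in M. state_at 0 \<omega> = i"
      using prob_eq_1 by (simp add: AE_iff_measurable)
  next
    fix n :: nat and h :: "('e, 'a, 'b) history" and a b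
    obtain l x where h: "h = (l, x)" by (cases h)
    show "measure M {\<omega> \<in> UNIV. hist_at n \<omega> = h \<and> act1_at n \<omega> = a \<and> act2_at n \<omega> = b}
        = measure M {\<omega> \<in> UNIV. hist_at n \<omega> = h} * (pmf (\<pi> n h) a * pmf (\<sigma> n h) b)"
    proof (cases "length l = n")
      case True
      then show ?thesis using full[of l x a b] hist[of l x] by (simp add: h \<kappa>)
    next
      case False
      then have "hist_at n \<omega> \<noteq> h" for \<omega> by (auto simp: h hist_at_def)
      then show ?thesis by simp
    qed
  next
    fix n :: nat and h :: "('e, 'a, 'b) history" and a b j
    obtain l x where h: "h = (l, x)" by (cases h)
    show "measure M {\<omega> \<in> UNIV. hist_at n \<omega> = h \<and> act1_at n \<omega> = a \<and> act2_at n \<omega> = b \<and> state_at (Suc n) \<omega> = j}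
        = measure M {\<omega> \<in> UNIV. hist_at n \<omega> = h \<and> act1_at n \<omega> = a \<and> act2_at n \<omega> = b} * pmf (P (snd h) a b) j"
    proof (cases "length l = n")
      case True
      then show ?thesis
        using hist[of "l @ [(x, a, b)]" j]
        by (simp add: h hist_at_Suc_eq map_upt_Suc_eq t_def del: upt_Suc)
    next
      case False
      then have "hist_at n \<omega> \<noteq> h" for \<omega> by (auto simp: h hist_at_def)
      then show ?thesis by simp
    qed
  qed (fact pM M)+
  then show ?thesis ..
qed

lemma is_game_measure_game_measure:
  fixes P :: "'e::finite \<Rightarrow> 'a::finite \<Rightarrow> 'b::finite \<Rightarrow> 'e pmf"
  shows "is_game_measure P i \<pi> \<sigma> (game_measure P i \<pi> \<sigma>)"
  unfolding game_measure_def
  by (rule theI') (blast intro: game_measure_exists game_measure_unique)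

text \<open>In \<open>enat\<close> the infimum of the empty set is \<open>\<infinity>\<close>.\<close>

definition hitting_time :: "'e \<Rightarrow> (nat \<Rightarrow> 'e \<times> 'a \<times> 'b) \<Rightarrow> enat" where
  "hitting_time j \<omega> = Inf (enat ` {n. n > 0 \<and> state_at n \<omega> = j})"

definition game_gamma ::
    "('e::finite \<Rightarrow> 'a::finite set) \<Rightarrow> ('e \<Rightarrow> 'b::finite set) \<Rightarrow> ('e \<Rightarrow> 'a \<Rightarrow> 'b \<Rightarrow> 'e pmf) \<Rightarrow> real" where
  "game_gamma A B P =
    (MIN (i, j) \<in> UNIV. INF \<pi> \<in> policies A B A. INF \<sigma> \<in> policies A B B.
      \<P>(\<omega> in game_measure P i \<pi> \<sigma>. hitting_time j \<omega> \<le> enat CARD('e)))"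

primrec game_V ::
    "('e::finite \<Rightarrow> 'a::finite set) \<Rightarrow> ('e \<Rightarrow> 'b::finite set) \<Rightarrow> ('e \<Rightarrow> 'a \<Rightarrow> 'b \<Rightarrow> 'e pmf)
      \<Rightarrow> 'e \<Rightarrow> nat \<Rightarrow> 'e \<Rightarrow> real" where
  "game_V A B P j 0 = (\<lambda>i. 1)"
| "game_V A B P j (Suc k) =
    (\<lambda>i. MAX a \<in> A i. MAX b \<in> B i. \<Sum>i1 \<in> UNIV - {j}. pmf (P i a b) i1 * game_V A B P j k i1)"

definition irreducible_under ::
    "('e \<Rightarrow> 'a \<Rightarrow> 'b \<Rightarrow> 'e pmf)
      \<Rightarrow> (nat \<Rightarrow> ('e, 'a, 'b) history \<Rightarrow> 'a pmf) \<Rightarrow> (nat \<Rightarrow> ('e, 'a, 'b) history \<Rightarrow> 'b pmf) \<Rightarrow> bool" where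
  "irreducible_under P \<pi> \<sigma> \<longleftrightarrow>
    (\<forall>i j. \<exists>n\<ge>1. \<P>(\<omega> in game_measure P i \<pi> \<sigma>. state_at n \<omega> = j) > 0)"

definition irreducibility_condition ::
    "('e \<Rightarrow> 'a set) \<Rightarrow> ('e \<Rightarrow> 'b set) \<Rightarrow> ('e \<Rightarrow> 'a \<Rightarrow> 'b \<Rightarrow> 'e pmf) \<Rightarrow> bool" where
  "irreducibility_condition A B P \<longleftrightarrow>
    (\<forall>f \<in> stationary_policies A B A. \<forall>g \<in> stationary_policies A B B. irreducible_under P f g)"

end

theory Submission
  imports Defs
begin

text \<open>
  Fix a target state \<open>j\<close>.  Given the history up to time \<open>n\<close>, the conditional probability that the
  next \<open>k\<close> states all differ from \<open>j\<close> satisfies a one-step recursion, the policy evaluation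
  \<open>avoid_prob\<close>.  Comparing that recursion with the one for \<open>game_V\<close> is dynamic programming for the
  two players jointly maximising the probability of avoiding \<open>j\<close>: an average over actions is at
  most the maximum over admissible actions (\<open>avoid_prob_le_game_V\<close>), and there is equality when
  both players pick a maximising pair for the number of steps that remain
  (\<open>avoid_prob_maximizers\<close>).  As \<open>\<tau>\<^sub>j > |E|\<close> says exactly that \<open>j\<close> is avoided at times
  \<open>1, \<dots>, |E|\<close>, the least probability of \<open>\<tau>\<^sub>j \<le> |E|\<close> from \<open>i\<close> is \<open>1 - V\<^sub>|\<^sub>E\<^sub>|\<^sup>j(i)\<close>, which is (a).

  For (b), if \<open>\<gamma> > 0\<close> then under any pair of policies every state is reached from every state
  with positive probability at some time in \<open>1, \<dots>, |E|\<close>.  Conversely, let \<open>S\<^sub>k\<close> be the set of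
  states with \<open>V\<^sub>k\<^sup>j = 1\<close>.  A sum defining \<open>V\<^sub>k\<^sub>+\<^sub>1\<^sup>j(i)\<close> equals 1 only if the transition
  law puts all its mass on \<open>S\<^sub>k - {j}\<close>, so \<open>S\<^sub>k\<^sub>+\<^sub>1\<close> is obtained from \<open>S\<^sub>k\<close> by a fixed monotone operator
  (\<open>game_V_eq_1_iff\<close>).  The sequence starts at \<open>E\<close> and decreases, hence it is constant from
  \<open>k = |E|\<close> on.  If \<open>\<gamma> = 0\<close> then \<open>S\<^sub>|\<^sub>E\<^sub>|\<close> is nonempty for some \<open>j\<close>, and being a fixed point
  of the operator it provides actions, depending on the current state only, that keep the process
  in \<open>S\<^sub>|\<^sub>E\<^sub>| - {j}\<close> forever.  This deterministic stationary pair violates irreducibility.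
\<close>

section \<open>Events that depend on finitely many coordinates\<close>

lemma sets_finitely_determined:
  fixes M :: "(nat \<Rightarrow> 's::finite) measure"
  assumes "sets M = sets (\<Pi>\<^sub>M n \<in> UNIV. count_space UNIV)"
    and R: "\<And>\<omega> \<omega>'. (\<And>k. k < m \<Longrightarrow> \<omega> k = \<omega>' k) \<Longrightarrow> R \<omega> \<longleftrightarrow> R \<omega>'"
  shows "{\<omega>. R \<omega>} \<in> sets M"
proof -
  have "R \<omega> \<longleftrightarrow> R (\<lambda>k. map \<omega> [0..<m] ! k)" for \<omega>
    by (rule R) simp
  then have "{\<omega>. R \<omega>} = {\<omega>. (\<lambda>l. R (\<lambda>k. l ! k)) (map \<omega> [0..<m])}"
    by auto
  also have "\<dots> \<in> sets M"
    by (rule sets_cylinder[OF assms(1)])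
  finally show ?thesis .
qed

definition avoids :: "'e \<Rightarrow> nat \<Rightarrow> nat \<Rightarrow> (nat \<Rightarrow> 'e \<times> 'a \<times> 'b) \<Rightarrow> bool" where
  "avoids j n k \<omega> \<longleftrightarrow> (\<forall>m\<in>{n<..n + k}. state_at m \<omega> \<noteq> j)"

lemma avoids_Suc: "avoids j n (Suc k) \<omega> \<longleftrightarrow> state_at (Suc n) \<omega> \<noteq> j \<and> avoids j (Suc n) k \<omega>"
proof -
  have "{n<..n + Suc k} = insert (Suc n) {Suc n<..Suc n + k}"
    by auto
  then show ?thesis
    by (simp add: avoids_def)
qed

lemma hitting_time_le_iff: "hitting_time j \<omega> \<le> enat N \<longleftrightarrow> \<not> avoids j 0 N \<omega>"
proof
  assume "\<not> avoids j 0 N \<omega>"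
  then obtain m where m: "0 < m" "m \<le> N" "state_at m \<omega> = j"
    by (auto simp: avoids_def)
  then have "hitting_time j \<omega> \<le> enat m"
    unfolding hitting_time_def by (intro Inf_lower) auto
  also have "\<dots> \<le> enat N"
    using m by simp
  finally show "hitting_time j \<omega> \<le> enat N" .
next
  assume le: "hitting_time j \<omega> \<le> enat N"
  show "\<not> avoids j 0 N \<omega>"
  proof
    assume av: "avoids j 0 N \<omega>"
    have "enat (Suc N) \<le> hitting_time j \<omega>"
      unfolding hitting_time_def
    proof (rule Inf_greatest)
      fix x assume "x \<in> enat ` {n. n > 0 \<and> state_at n \<omega> = j}"
      then obtain n where "x = enat n" "n > 0" "state_at n \<omega> = j"
        by auto
      then show "enat (Suc N) \<le> x"
        using av by (force simp: avoids_def not_less_eq_eq)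
    qed
    from order_trans[OF this le] show False
      by simp
  qed
qed

lemma sets_avoids:
  fixes M :: "(nat \<Rightarrow> 'e::finite \<times> 'a::finite \<times> 'b::finite) measure"
  assumes "sets M = sets (\<Pi>\<^sub>M n \<in> UNIV. count_space UNIV)"
  shows "{\<omega>. avoids j n k \<omega>} \<in> sets M"
  by (rule sets_finitely_determined[OF assms, where m="Suc (n + k)"])
     (simp add: avoids_def state_at_def)

lemma sets_hist_avoids:
  fixes M :: "(nat \<Rightarrow> 'e::finite \<times> 'a::finite \<times> 'b::finite) measure"
  assumes "sets M = sets (\<Pi>\<^sub>M n \<in> UNIV. count_space UNIV)"
  shows "{\<omega>. hist_at n \<omega> = h \<and> avoids j n k \<omega>} \<in> sets M"
proof (rule sets_finitely_determined[OF assms, where m="Suc (n + k)"])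
  fix \<omega> \<omega>' :: "nat \<Rightarrow> 'e \<times> 'a \<times> 'b"
  assume eq: "\<And>i. i < Suc (n + k) \<Longrightarrow> \<omega> i = \<omega>' i"
  then have "hist_at n \<omega> = hist_at n \<omega>'"
    by (simp add: hist_at_def state_at_def)
  moreover have "avoids j n k \<omega> \<longleftrightarrow> avoids j n k \<omega>'"
    using eq by (simp add: avoids_def state_at_def)
  ultimately show "hist_at n \<omega> = h \<and> avoids j n k \<omega> \<longleftrightarrow> hist_at n \<omega>' = h \<and> avoids j n k \<omega>'"
    by simp
qed

section \<open>Evaluation of a pair of policies\<close>

text \<open>
  The conditional probability, given the history \<open>h\<close> at time \<open>n\<close>, that the states at times
  \<open>n + 1, \<dots>, n + k\<close> differ from \<open>j\<close>; \<open>measure_hist_avoids\<close> justifies this reading.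
\<close>

primrec avoid_prob ::
    "('e::finite \<Rightarrow> 'a::finite \<Rightarrow> 'b::finite \<Rightarrow> 'e pmf)
      \<Rightarrow> (nat \<Rightarrow> ('e, 'a, 'b) history \<Rightarrow> 'a pmf) \<Rightarrow> (nat \<Rightarrow> ('e, 'a, 'b) history \<Rightarrow> 'b pmf)
      \<Rightarrow> 'e \<Rightarrow> nat \<Rightarrow> nat \<Rightarrow> ('e, 'a, 'b) history \<Rightarrow> real" where
  "avoid_prob P \<pi> \<sigma> j 0 = (\<lambda>n h. 1)"
| "avoid_prob P \<pi> \<sigma> j (Suc k) = (\<lambda>n h. \<Sum>a\<in>UNIV. \<Sum>b\<in>UNIV. pmf (\<pi> n h) a * pmf (\<sigma> n h) b *
    (\<Sum>x\<in>UNIV - {j}. pmf (P (snd h) a b) x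
      * avoid_prob P \<pi> \<sigma> j k (Suc n) (fst h @ [(snd h, a, b)], x)))"

lemma avoid_prob_Suc_deterministic:
  assumes "\<pi> n h = return_pmf a" "\<sigma> n h = return_pmf b"
  shows "avoid_prob P \<pi> \<sigma> j (Suc k) n h = (\<Sum>x\<in>UNIV - {j}. pmf (P (snd h) a b) x
      * avoid_prob P \<pi> \<sigma> j k (Suc n) (fst h @ [(snd h, a, b)], x))"
  (is "_ = ?r a b")
proof -
  have "avoid_prob P \<pi> \<sigma> j (Suc k) n h
      = (\<Sum>a'\<in>UNIV. \<Sum>b'\<in>UNIV. indicator {a} a' * (indicator {b} b' * ?r a' b'))"
    by (simp add: assms pmf_return mult.assoc indicator_def eq_commute)
  also have "\<dots> = (\<Sum>a'\<in>UNIV. indicator {a} a' * (\<Sum>b'\<in>UNIV. indicator {b} b' * ?r a' b'))"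
    by (simp only: sum_distrib_left)
  also have "\<dots> = ?r a b"
    by (simp add: indicator_def if_distrib[where f="\<lambda>c. c * _"] sum.delta cong: if_cong)
  finally show ?thesis .
qed

text \<open>
  The event splits according to the actions at time \<open>n\<close> and the state at time \<open>n + 1\<close>; on each piece
  the history at time \<open>n + 1\<close> is known, and the two conditional laws of the game measure produce the
  weights in \<open>avoid_prob\<close>.
\<close>

lemma measure_hist_avoids:
  fixes P :: "'e::finite \<Rightarrow> 'a::finite \<Rightarrow> 'b::finite \<Rightarrow> 'e pmf"
  assumes M: "is_game_measure P i \<pi> \<sigma> M"
  shows "measure M {\<omega>. hist_at n \<omega> = h \<and> avoids j n k \<omega>}
    = measure M {\<omega>. hist_at n \<omega> = h} * avoid_prob P \<pi> \<sigma> j k n h"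
proof (induction k arbitrary: n h)
  case 0
  then show ?case
    by (simp add: avoids_def)
next
  case (Suc k)
  have S: "sets M = sets (\<Pi>\<^sub>M n \<in> UNIV. count_space UNIV)" and pM: "prob_space M"
    using M by (simp_all add: is_game_measure_def)
  interpret prob_space M by (fact pM)
  have sp: "space M = UNIV" by (rule space_traj[OF S])
  obtain l x where h: "h = (l, x)" by (cases h)
  define next_hist :: "'a \<times> 'b \<times> 'e \<Rightarrow> ('e, 'a, 'b) history"
    where "next_hist = (\<lambda>(a, b, y). (l @ [(x, a, b)], y))"
  define piece where
    "piece q = {\<omega>. hist_at (Suc n) \<omega> = next_hist q \<and> avoids j (Suc n) k \<omega>}" for q
  let ?Q = "UNIV \<times> UNIV \<times> (UNIV - {j})"
  let ?av = "\<lambda>a b y. avoid_prob P \<pi> \<sigma> j k (Suc n) (l @ [(x, a, b)], y)"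
  have step: "measure M (piece (a, b, y)) = measure M {\<omega>. hist_at n \<omega> = h} *
      (pmf (\<pi> n h) a * pmf (\<sigma> n h) b * (pmf (P x a b) y * ?av a b y))" for a b y
  proof -
    have "measure M (piece (a, b, y))
        = measure M {\<omega>. hist_at (Suc n) \<omega> = (l @ [(x, a, b)], y)} * ?av a b y"
      unfolding piece_def by (simp add: Suc.IH next_hist_def)
    also have "measure M {\<omega>. hist_at (Suc n) \<omega> = (l @ [(x, a, b)], y)}
        = measure M {\<omega>. hist_at n \<omega> = h} * (pmf (\<pi> n h) a * pmf (\<sigma> n h) b) * pmf (P x a b) y"
      using M by (simp add: is_game_measure_def sp hist_at_Suc_eq h)
    finally show ?thesis
      by (simp add: mult_ac)
  qed
  have "{\<omega>. hist_at n \<omega> = h \<and> avoids j n (Suc k) \<omega>} = (\<Union>q\<in>?Q. piece q)"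
    by (auto simp: piece_def next_hist_def avoids_Suc hist_at_Suc_eq h)
  also have "measure M \<dots> = (\<Sum>q\<in>?Q. measure M (piece q))"
    by (intro finite_measure_finite_Union)
       (auto simp: disjoint_family_on_def piece_def next_hist_def intro!: sets_hist_avoids[OF S])
  also have "\<dots> = (\<Sum>a\<in>UNIV. \<Sum>b\<in>UNIV. \<Sum>y\<in>UNIV - {j}. measure M (piece (a, b, y)))"
    by (simp add: sum.cartesian_product)
  also have "\<dots> = measure M {\<omega>. hist_at n \<omega> = h} * avoid_prob P \<pi> \<sigma> j (Suc k) n h"
    by (simp add: step h sum_distrib_left)
  finally show ?case .
qed

lemma prob_avoids:
  fixes P :: "'e::finite \<Rightarrow> 'a::finite \<Rightarrow> 'b::finite \<Rightarrow> 'e pmf"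
  shows "measure (game_measure P i \<pi> \<sigma>) {\<omega>. avoids j 0 k \<omega>} = avoid_prob P \<pi> \<sigma> j k 0 ([], i)"
proof -
  let ?M = "game_measure P i \<pi> \<sigma>"
  note M = is_game_measure_game_measure[of P i \<pi> \<sigma>]
  have S: "sets ?M = sets (\<Pi>\<^sub>M n \<in> UNIV. count_space UNIV)" and pM: "prob_space ?M"
    and start: "AE \<omega> in ?M. state_at 0 \<omega> = i"
    using M by (simp_all add: is_game_measure_def)
  interpret prob_space ?M by (fact pM)
  have hist: "AE \<omega> in ?M. hist_at 0 \<omega> = ([], i)"
    using start by eventually_elim (simp add: hist_at_0_eq)
  have "measure ?M {\<omega>. avoids j 0 k \<omega>} = measure ?M {\<omega>. hist_at 0 \<omega> = ([], i) \<and> avoids j 0 k \<omega>}"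
    using hist by (intro finite_measure_eq_AE sets_avoids[OF S] sets_hist_avoids[OF S]) auto
  moreover have "measure ?M {\<omega>. hist_at 0 \<omega> = ([], i)} = 1"
    using hist sets_hist_avoids[OF S, of 0 "([], i)" j 0]
    by (subst prob_eq_1) (auto simp: avoids_def)
  ultimately show ?thesis
    by (simp add: measure_hist_avoids[OF M])
qed

lemma prob_hitting_time_le:
  fixes P :: "'e::finite \<Rightarrow> 'a::finite \<Rightarrow> 'b::finite \<Rightarrow> 'e pmf"
  shows "\<P>(\<omega> in game_measure P i \<pi> \<sigma>. hitting_time j \<omega> \<le> enat N)
    = 1 - avoid_prob P \<pi> \<sigma> j N 0 ([], i)"
proof -
  let ?M = "game_measure P i \<pi> \<sigma>"
  have S: "sets ?M = sets (\<Pi>\<^sub>M n \<in> UNIV. count_space UNIV)" and pM: "prob_space ?M"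
    using is_game_measure_game_measure[of P i \<pi> \<sigma>] by (simp_all add: is_game_measure_def)
  interpret prob_space ?M by (fact pM)
  have "{\<omega> \<in> space ?M. hitting_time j \<omega> \<le> enat N} = space ?M - {\<omega>. avoids j 0 N \<omega>}"
    by (auto simp: hitting_time_le_iff)
  then show ?thesis
    using prob_compl[OF sets_avoids[OF S, of j 0 N]] by (simp add: prob_avoids)
qed

section \<open>Dynamic programming\<close>

lemma MAX_MAX_ge:
  fixes c :: "'a::finite \<Rightarrow> 'b::finite \<Rightarrow> real"
  assumes "a \<in> X" "b \<in> Y"
  shows "c a b \<le> (MAX a\<in>X. MAX b\<in>Y. c a b)"
proof -
  have "c a b \<le> (MAX b\<in>Y. c a b)"
    using assms by (intro Max_ge) auto
  also have "\<dots> \<le> (MAX a\<in>X. MAX b\<in>Y. c a b)"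
    using assms by (intro Max_ge) auto
  finally show ?thesis .
qed

lemma MAX_MAX_attained:
  fixes c :: "'a::finite \<Rightarrow> 'b::finite \<Rightarrow> real"
  assumes "X \<noteq> {}" "Y \<noteq> {}"
  obtains a b where "a \<in> X" "b \<in> Y" "(MAX a\<in>X. MAX b\<in>Y. c a b) = c a b"
proof -
  have "(MAX a\<in>X. MAX b\<in>Y. c a b) \<in> (\<lambda>a. MAX b\<in>Y. c a b) ` X"
    using assms by (intro Max_in) auto
  then obtain a where a: "a \<in> X" "(MAX a\<in>X. MAX b\<in>Y. c a b) = (MAX b\<in>Y. c a b)"
    by auto
  have "(MAX b\<in>Y. c a b) \<in> c a ` Y"
    using assms by (intro Max_in) auto
  with a that show thesis
    by auto
qed

lemma average_le_bound:
  fixes c :: "'a::finite \<Rightarrow> 'b::finite \<Rightarrow> real"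
  assumes "\<And>a b. a \<in> set_pmf p \<Longrightarrow> b \<in> set_pmf q \<Longrightarrow> c a b \<le> m"
  shows "(\<Sum>a\<in>UNIV. \<Sum>b\<in>UNIV. pmf p a * pmf q b * c a b) \<le> m"
proof -
  have "(\<Sum>a\<in>UNIV. \<Sum>b\<in>UNIV. pmf p a * pmf q b * c a b)
      \<le> (\<Sum>a\<in>UNIV. \<Sum>b\<in>UNIV. pmf p a * pmf q b * m)"
  proof (intro sum_mono)
    fix a b
    show "pmf p a * pmf q b * c a b \<le> pmf p a * pmf q b * m"
    proof (cases "pmf p a = 0 \<or> pmf q b = 0")
      case False
      then show ?thesis
        by (intro mult_left_mono assms) (auto simp: set_pmf_iff)
    qed auto
  qed
  also have "\<dots> = (\<Sum>a\<in>UNIV. pmf p a) * (\<Sum>b\<in>UNIV. pmf q b) * m"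
    by (subst sum_product) (simp only: sum_distrib_right)
  also have "\<dots> = m"
    by (simp add: sum_pmf_eq_1)
  finally show ?thesis .
qed

lemma policies_iff:
  "\<pi> \<in> policies A B C \<longleftrightarrow> (\<forall>n. \<forall>h\<in>histories A B n. set_pmf (\<pi> n h) \<subseteq> C (snd h))"
  by (auto simp: policies_def measure_pmf.prob_eq_1 AE_measure_pmf_iff)

lemma avoid_prob_le_game_V:
  fixes P :: "'e::finite \<Rightarrow> 'a::finite \<Rightarrow> 'b::finite \<Rightarrow> 'e pmf"
  assumes \<pi>: "\<pi> \<in> policies A B A" and \<sigma>: "\<sigma> \<in> policies A B B"
    and "h \<in> histories A B n"
  shows "avoid_prob P \<pi> \<sigma> j k n h \<le> game_V A B P j k (snd h)"
  using assms(3)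
proof (induction k arbitrary: n h)
  case 0
  then show ?case by simp
next
  case (Suc k)
  let ?c = "\<lambda>a b. \<Sum>x\<in>UNIV - {j}. pmf (P (snd h) a b) x * game_V A B P j k x"
  show ?case
    unfolding avoid_prob.simps
  proof (rule average_le_bound)
    fix a b
    assume "a \<in> set_pmf (\<pi> n h)" "b \<in> set_pmf (\<sigma> n h)"
    then have ab: "a \<in> A (snd h)" "b \<in> B (snd h)"
      using \<pi> \<sigma> Suc.prems unfolding policies_iff by blast+
    then have "(fst h @ [(snd h, a, b)], x) \<in> histories A B (Suc n)" for x
      using Suc.prems by (auto simp: histories_def admissible_def)
    then have "(\<Sum>x\<in>UNIV - {j}. pmf (P (snd h) a b) x
        * avoid_prob P \<pi> \<sigma> j k (Suc n) (fst h @ [(snd h, a, b)], x)) \<le> ?c a b"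
      using Suc.IH by (intro sum_mono mult_left_mono) fastforce+
    also have "\<dots> \<le> game_V A B P j (Suc k) (snd h)"
      using MAX_MAX_ge[of a "A (snd h)" b "B (snd h)" ?c] ab by simp
    finally show "(\<Sum>x\<in>UNIV - {j}. pmf (P (snd h) a b) x
        * avoid_prob P \<pi> \<sigma> j k (Suc n) (fst h @ [(snd h, a, b)], x))
        \<le> game_V A B P j (Suc k) (snd h)" .
  qed
qed

text \<open>
  The maximising pair depends on the number of remaining steps, so the optimal policies are
  deterministic and Markov but not stationary: at time \<open>n\<close> they use the actions for horizon
  \<open>N - n\<close>.
\<close>

lemma avoid_prob_maximizers:
  fixes P :: "'e::finite \<Rightarrow> 'a::finite \<Rightarrow> 'b::finite \<Rightarrow> 'e pmf"
  assumes opt: "\<And>k i. game_V A B P j (Suc k) i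
      = (\<Sum>x\<in>UNIV - {j}. pmf (P i (f (Suc k) i) (g (Suc k) i)) x * game_V A B P j k x)"
    and "n + k = N"
  shows "avoid_prob P (\<lambda>n h. return_pmf (f (N - n) (snd h))) (\<lambda>n h. return_pmf (g (N - n) (snd h)))
      j k n h = game_V A B P j k (snd h)"
  using assms(2)
proof (induction k arbitrary: n h)
  case 0
  then show ?case by simp
next
  case (Suc k)
  from Suc.prems have "N - n = Suc k" "Suc n + k = N"
    by auto
  then show ?case
    by (simp add: avoid_prob_Suc_deterministic Suc.IH opt del: avoid_prob.simps(2) game_V.simps(2))
qed

lemma game_V_step_attained:
  fixes A :: "'e::finite \<Rightarrow> 'a::finite set" and B :: "'e \<Rightarrow> 'b::finite set"
  assumes "A i \<noteq> {}" "B i \<noteq> {}"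
  obtains a b where "a \<in> A i" "b \<in> B i"
    "game_V A B P j (Suc k) i = (\<Sum>x\<in>UNIV - {j}. pmf (P i a b) x * game_V A B P j k x)"
proof -
  obtain a b where "a \<in> A i" "b \<in> B i"
    "(MAX a\<in>A i. MAX b\<in>B i. \<Sum>x\<in>UNIV - {j}. pmf (P i a b) x * game_V A B P j k x)
      = (\<Sum>x\<in>UNIV - {j}. pmf (P i a b) x * game_V A B P j k x)"
    by (rule MAX_MAX_attained[OF assms])
  then show thesis
    by (intro that) simp_all
qed

lemma optimal_policies:
  fixes A :: "'e::finite \<Rightarrow> 'a::finite set" and B :: "'e \<Rightarrow> 'b::finite set"
  assumes "\<And>i. A i \<noteq> {}" "\<And>i. B i \<noteq> {}"
  obtains \<pi> \<sigma> where "\<pi> \<in> policies A B A" "\<sigma> \<in> policies A B B"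
    "\<And>i. avoid_prob P \<pi> \<sigma> j N 0 ([], i) = game_V A B P j N i"
proof -
  \<comment> \<open>At horizon 0 there is nothing to maximise, and any admissible pair will do.\<close>
  define good where "good k i a b \<longleftrightarrow> a \<in> A i \<and> b \<in> B i \<and> (\<forall>k'. k = Suc k' \<longrightarrow>
      game_V A B P j k i = (\<Sum>x\<in>UNIV - {j}. pmf (P i a b) x * game_V A B P j k' x))" for k i a b
  have "\<exists>a b. good k i a b" for k i
  proof (cases k)
    case 0
    then show ?thesis
      using assms[of i] by (auto simp: good_def)
  next
    case (Suc k')
    obtain a b where "a \<in> A i" "b \<in> B i"
      "game_V A B P j (Suc k') i = (\<Sum>x\<in>UNIV - {j}. pmf (P i a b) x * game_V A B P j k' x)"
      using game_V_step_attained[of A i B P j k'] assms by metis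
    then show ?thesis
      unfolding good_def Suc by blast
  qed
  then obtain f g where fg: "\<And>k i. good k i (f k i) (g k i)"
    by metis
  show thesis
  proof
    show "(\<lambda>n h. return_pmf (f (N - n) (snd h))) \<in> policies A B A"
      and "(\<lambda>n h. return_pmf (g (N - n) (snd h))) \<in> policies A B B"
      using fg by (auto simp: policies_iff good_def)
    show "avoid_prob P (\<lambda>n h. return_pmf (f (N - n) (snd h)))
        (\<lambda>n h. return_pmf (g (N - n) (snd h))) j N 0 ([], i) = game_V A B P j N i" for i
      using fg by (subst avoid_prob_maximizers) (auto simp: good_def simp del: game_V.simps)
  qed
qed

lemma cINF_eq_attained:
  fixes f :: "'c \<Rightarrow> real"
  assumes "x \<in> X" "f x = m" "\<And>y. y \<in> X \<Longrightarrow> m \<le> f y"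
  shows "(INF y\<in>X. f y) = m"
  using assms by (intro cInf_eq_minimum) auto

lemma INF_prob_hitting_time:
  fixes A :: "'e::finite \<Rightarrow> 'a::finite set" and B :: "'e \<Rightarrow> 'b::finite set"
  assumes "\<And>i. A i \<noteq> {}" "\<And>i. B i \<noteq> {}"
  shows "(INF \<pi> \<in> policies A B A. INF \<sigma> \<in> policies A B B.
      \<P>(\<omega> in game_measure P i \<pi> \<sigma>. hitting_time j \<omega> \<le> enat N)) = 1 - game_V A B P j N i"
proof -
  obtain \<pi> \<sigma> where opt: "\<pi> \<in> policies A B A" "\<sigma> \<in> policies A B B"
      "avoid_prob P \<pi> \<sigma> j N 0 ([], i) = game_V A B P j N i"
    using optimal_policies[of A B P j N] assms by metis
  let ?p = "\<lambda>\<pi> \<sigma>. 1 - avoid_prob P \<pi> \<sigma> j N 0 ([], i)"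
  have le: "1 - game_V A B P j N i \<le> ?p \<pi>' \<sigma>'"
    if "\<pi>' \<in> policies A B A" "\<sigma>' \<in> policies A B B" for \<pi>' \<sigma>'
    using avoid_prob_le_game_V[OF that, where h="([], i)" and n=0] by (simp add: histories_def)
  have "(INF \<pi>' \<in> policies A B A. INF \<sigma>' \<in> policies A B B. ?p \<pi>' \<sigma>') = 1 - game_V A B P j N i"
  proof (rule cINF_eq_attained[OF opt(1)])
    show "(INF \<sigma>' \<in> policies A B B. ?p \<pi> \<sigma>') = 1 - game_V A B P j N i"
      using opt le by (intro cINF_eq_attained[OF opt(2)]) auto
    show "1 - game_V A B P j N i \<le> (INF \<sigma>' \<in> policies A B B. ?p \<pi>' \<sigma>')"
      if "\<pi>' \<in> policies A B A" for \<pi>'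
      using opt(2) le[OF that] by (intro cINF_greatest) auto
  qed
  then show ?thesis
    by (simp add: prob_hitting_time_le)
qed

lemma game_gamma_eq:
  fixes A :: "'e::finite \<Rightarrow> 'a::finite set" and B :: "'e \<Rightarrow> 'b::finite set"
  assumes "\<And>i. A i \<noteq> {}" "\<And>i. B i \<noteq> {}"
  shows "game_gamma A B P = 1 - (MAX (i, j) \<in> UNIV. game_V A B P j CARD('e) i)"
proof -
  let ?V = "\<lambda>(i, j). game_V A B P j CARD('e) i"
  have "game_gamma A B P = (MIN q \<in> UNIV. 1 - ?V q)"
    by (simp add: game_gamma_def INF_prob_hitting_time[OF assms] split_def)
  also have "\<dots> = 1 - (MAX q \<in> UNIV. ?V q)"
  proof (rule Min_eqI)
    have "Max (range ?V) \<in> range ?V"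
      by (intro Max_in) auto
    then obtain q where "Max (range ?V) = ?V q"
      by blast
    then show "1 - Max (range ?V) \<in> range (\<lambda>q. 1 - ?V q)"
      by (metis rangeI)
    show "1 - Max (range ?V) \<le> y" if y: "y \<in> range (\<lambda>q. 1 - ?V q)" for y
    proof -
      obtain q where "y = 1 - ?V q"
        using y by blast
      moreover have "?V q \<le> Max (range ?V)"
        by (intro Max_ge) auto
      ultimately show ?thesis
        by linarith
    qed
  qed simp
  finally show ?thesis .
qed

section \<open>States from which the target can surely be avoided\<close>

text \<open>
  As \<open>p\<close> has total mass 1, the gap between 1 and the sum is a \<open>p\<close>-average of the nonnegative
  losses \<open>d\<close> below, where mass on \<open>j\<close> is lost entirely; it vanishes only if every term does.
\<close>

lemma restricted_average_eq_1_iff: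
  fixes p :: "'e::finite pmf"
  assumes v: "\<And>x. v x \<le> (1::real)"
  shows "(\<Sum>x\<in>UNIV - {j}. pmf p x * v x) = 1 \<longleftrightarrow> set_pmf p \<subseteq> {x. v x = 1} - {j}"
    and "(\<Sum>x\<in>UNIV - {j}. pmf p x * v x) \<le> 1"
proof -
  define d where "d x = (if x = j then 1 else 1 - v x)" for x
  have nonneg: "pmf p x * d x \<ge> 0" for x
    using v by (simp add: d_def)
  have "(\<Sum>x\<in>UNIV. pmf p x * d x)
      = pmf p j * d j + (\<Sum>x\<in>UNIV - {j}. pmf p x * d x)"
    by (rule sum.remove) auto
  also have "\<dots> = (pmf p j + (\<Sum>x\<in>UNIV - {j}. pmf p x)) - (\<Sum>x\<in>UNIV - {j}. pmf p x * v x)"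
    by (simp add: d_def right_diff_distrib sum_subtractf)
  also have "pmf p j + (\<Sum>x\<in>UNIV - {j}. pmf p x) = (\<Sum>x\<in>UNIV. pmf p x)"
    by (rule sum.remove[symmetric]) auto
  also have "\<dots> = 1"
    by (simp add: sum_pmf_eq_1)
  finally have defect: "(\<Sum>x\<in>UNIV. pmf p x * d x) = 1 - (\<Sum>x\<in>UNIV - {j}. pmf p x * v x)" .
  then have "(\<Sum>x\<in>UNIV - {j}. pmf p x * v x) = 1 \<longleftrightarrow> (\<Sum>x\<in>UNIV. pmf p x * d x) = 0"
    by auto
  also have "\<dots> \<longleftrightarrow> (\<forall>x. pmf p x * d x = 0)"
    using nonneg by (subst sum_nonneg_eq_0_iff) auto
  also have "\<dots> \<longleftrightarrow> set_pmf p \<subseteq> {x. v x = 1} - {j}"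
    by (auto simp: d_def set_pmf_iff split: if_splits)
  finally show "(\<Sum>x\<in>UNIV - {j}. pmf p x * v x) = 1 \<longleftrightarrow> set_pmf p \<subseteq> {x. v x = 1} - {j}" .
  show "(\<Sum>x\<in>UNIV - {j}. pmf p x * v x) \<le> 1"
    using defect sum_nonneg[of UNIV "\<lambda>x. pmf p x * d x"] nonneg by simp
qed

lemma game_V_le_1:
  fixes A :: "'e::finite \<Rightarrow> 'a::finite set" and B :: "'e \<Rightarrow> 'b::finite set"
  assumes "\<And>i. A i \<noteq> {}" "\<And>i. B i \<noteq> {}"
  shows "game_V A B P j k i \<le> 1"
proof (induction k arbitrary: i)
  case (Suc k)
  obtain a b where
    "game_V A B P j (Suc k) i = (\<Sum>x\<in>UNIV - {j}. pmf (P i a b) x * game_V A B P j k x)"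
    using game_V_step_attained[of A i B P j k] assms by metis
  then show ?case
    using restricted_average_eq_1_iff(2) Suc.IH by metis
qed simp

definition can_stay :: "('e \<Rightarrow> 'a set) \<Rightarrow> ('e \<Rightarrow> 'b set) \<Rightarrow> ('e \<Rightarrow> 'a \<Rightarrow> 'b \<Rightarrow> 'e pmf)
      \<Rightarrow> 'e \<Rightarrow> 'e set \<Rightarrow> 'e set" where
  "can_stay A B P j S = {i. \<exists>a\<in>A i. \<exists>b\<in>B i. set_pmf (P i a b) \<subseteq> S - {j}}"

lemma can_stay_mono: "S \<subseteq> T \<Longrightarrow> can_stay A B P j S \<subseteq> can_stay A B P j T"
  unfolding can_stay_def by blast

lemma game_V_eq_1_iff:
  fixes A :: "'e::finite \<Rightarrow> 'a::finite set" and B :: "'e \<Rightarrow> 'b::finite set"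
  assumes ne: "\<And>i. A i \<noteq> {}" "\<And>i. B i \<noteq> {}"
  shows "{i. game_V A B P j (Suc k) i = 1} = can_stay A B P j {i. game_V A B P j k i = 1}"
proof (intro set_eqI iffI)
  note le1 = game_V_le_1[where A=A and B=B and P=P, OF ne]
  fix i
  {
    assume i: "i \<in> {i. game_V A B P j (Suc k) i = 1}"
    obtain a b where "a \<in> A i" "b \<in> B i"
      "game_V A B P j (Suc k) i = (\<Sum>x\<in>UNIV - {j}. pmf (P i a b) x * game_V A B P j k x)"
      using game_V_step_attained[of A i B P j k] ne by metis
    moreover from this have "set_pmf (P i a b) \<subseteq> {x. game_V A B P j k x = 1} - {j}"
      using i restricted_average_eq_1_iff(1)[of "game_V A B P j k", OF le1] by auto
    ultimately show "i \<in> can_stay A B P j {i. game_V A B P j k i = 1}"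
      unfolding can_stay_def by blast
  }
  {
    assume "i \<in> can_stay A B P j {i. game_V A B P j k i = 1}"
    then obtain a b where ab: "a \<in> A i" "b \<in> B i"
      and "set_pmf (P i a b) \<subseteq> {x. game_V A B P j k x = 1} - {j}"
      unfolding can_stay_def by blast
    then have "1 = (\<Sum>x\<in>UNIV - {j}. pmf (P i a b) x * game_V A B P j k x)"
      using restricted_average_eq_1_iff(1)[of "game_V A B P j k", OF le1] by metis
    also have "\<dots> \<le> game_V A B P j (Suc k) i"
      using MAX_MAX_ge[of a "A i" b "B i"
          "\<lambda>a b. \<Sum>x\<in>UNIV - {j}. pmf (P i a b) x * game_V A B P j k x"] ab
      by simp
    finally show "i \<in> {i. game_V A B P j (Suc k) i = 1}"
      using le1[where j=j and k="Suc k" and i=i] by simp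
  }
qed

text \<open>
  The complements of the sets \<open>{V\<^sub>k = 1}\<close> form an increasing sequence of subsets of \<open>E\<close> that
  stays constant once two consecutive terms agree, so at most \<open>|E|\<close> strict increases occur.
\<close>

lemma game_V_eq_1_fixpoint:
  fixes A :: "'e::finite \<Rightarrow> 'a::finite set" and B :: "'e \<Rightarrow> 'b::finite set"
    and P :: "'e \<Rightarrow> 'a \<Rightarrow> 'b \<Rightarrow> 'e pmf" and j :: 'e
  assumes ne: "\<And>i. A i \<noteq> {}" "\<And>i. B i \<noteq> {}"
  defines "S \<equiv> {i. game_V A B P j CARD('e) i = 1}"
  shows "can_stay A B P j S = S"
proof -
  define T where "T k = {i. game_V A B P j k i = 1}" for k
  have T: "T (Suc k) = can_stay A B P j (T k)" for k
    unfolding T_def by (rule game_V_eq_1_iff[OF ne])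
  have T0: "T 0 = UNIV"
    by (simp add: T_def)
  have dec: "T (Suc k) \<subseteq> T k" for k
  proof (induction k)
    case (Suc k)
    then show ?case
      using can_stay_mono[of "T (Suc k)" "T k" A B P j] by (simp flip: T)
  qed (simp add: T0)
  have mono: "mono (\<lambda>k. - T k)"
    using dec by (intro incseq_SucI) auto
  have stable: "\<forall>n. - T n = - T (Suc n) \<longrightarrow> - T (Suc n) = - T (Suc (Suc n))"
    by (metis T boolean_algebra_class.boolean_algebra.compl_eq_compl_iff)
  have "\<exists>N. (\<forall>n\<le>N. \<forall>m\<le>N. m < n \<longrightarrow> - T m \<subset> - T n) \<and> (\<forall>n\<ge>N. - T N = - T n)"
    using finite_mono_remains_stable_implies_strict_prefix[OF _ mono stable] by simp
  then have "- T CARD('e) = (\<Union>n. - T n)"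
    by (intro finite_mono_strict_prefix_implies_finite_fixpoint) auto
  then have "- T (Suc CARD('e)) \<subseteq> - T CARD('e)"
    by blast
  with dec[of "CARD('e)"] have "T (Suc CARD('e)) = T CARD('e)"
    by blast
  then show ?thesis
    using T[of "CARD('e)"] by (simp add: T_def S_def)
qed

text \<open>
  Stationary choices that keep the process in \<open>S - {j}\<close> avoid \<open>j\<close> over every horizon, not only up
  to \<open>|E|\<close>; this is what contradicts irreducibility.
\<close>

lemma avoid_prob_invariant_set:
  fixes P :: "'e::finite \<Rightarrow> 'a::finite \<Rightarrow> 'b::finite \<Rightarrow> 'e pmf"
  assumes inv: "\<And>i. i \<in> S \<Longrightarrow> set_pmf (P i (f i) (g i)) \<subseteq> S - {j}" and "snd h \<in> S"
  shows "avoid_prob P (\<lambda>n h. return_pmf (f (snd h))) (\<lambda>n h. return_pmf (g (snd h))) j k n h = 1"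
  using assms(2)
proof (induction k arbitrary: n h)
  case (Suc k)
  let ?\<pi> = "\<lambda>n h. return_pmf (f (snd h))" and ?\<sigma> = "\<lambda>n h. return_pmf (g (snd h))"
  let ?p = "P (snd h) (f (snd h)) (g (snd h))"
  have "avoid_prob P ?\<pi> ?\<sigma> j (Suc k) n h = (\<Sum>x\<in>UNIV - {j}. pmf ?p x
      * avoid_prob P ?\<pi> ?\<sigma> j k (Suc n) (fst h @ [(snd h, f (snd h), g (snd h))], x))"
    by (rule avoid_prob_Suc_deterministic) auto
  also have "\<dots> = (\<Sum>x\<in>UNIV - {j}. pmf ?p x)"
  proof (rule sum.cong)
    fix x
    show "pmf ?p x * avoid_prob P ?\<pi> ?\<sigma> j k (Suc n) (fst h @ [(snd h, f (snd h), g (snd h))], x)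
        = pmf ?p x"
    proof (cases "x \<in> set_pmf ?p")
      case True
      then have "x \<in> S"
        using inv[OF Suc.prems] by blast
      then show ?thesis
        by (simp add: Suc.IH)
    next
      case False
      then show ?thesis
        by (simp add: pmf_eq_0_set_pmf)
    qed
  qed simp
  also have "\<dots> = 1"
    using inv[OF Suc.prems] by (intro sum_pmf_eq_1) auto
  finally show ?case .
qed simp

section \<open>Irreducibility\<close>

lemma irreducible_under_imp_avoid_prob_less_1:
  fixes P :: "'e::finite \<Rightarrow> 'a::finite \<Rightarrow> 'b::finite \<Rightarrow> 'e pmf"
  assumes "irreducible_under P \<pi> \<sigma>"
  obtains k where "avoid_prob P \<pi> \<sigma> j k 0 ([], i) < 1"
proof -
  let ?M = "game_measure P i \<pi> \<sigma>"
  have S: "sets ?M = sets (\<Pi>\<^sub>M n \<in> UNIV. count_space UNIV)" and pM: "prob_space ?M"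
    using is_game_measure_game_measure[of P i \<pi> \<sigma>] by (simp_all add: is_game_measure_def)
  interpret prob_space ?M by (fact pM)
  obtain k where k: "k \<ge> 1" "\<P>(\<omega> in ?M. state_at k \<omega> = j) > 0"
    using assms unfolding irreducible_under_def by blast
  note k(2)
  also have "\<P>(\<omega> in ?M. state_at k \<omega> = j) \<le> prob (space ?M - {\<omega>. avoids j 0 k \<omega>})"
    using k(1) sets_avoids[OF S, of j 0 k]
    by (intro finite_measure_mono sets.compl_sets) (auto simp: avoids_def)
  also have "\<dots> = 1 - avoid_prob P \<pi> \<sigma> j k 0 ([], i)"
    using prob_compl[OF sets_avoids[OF S, of j 0 k]] by (simp add: prob_avoids)
  finally show thesis
    using that by simp
qed

text \<open>
  If \<open>j\<close> had probability 0 at each of the finitely many times \<open>1, \<dots>, N\<close>, it would almost surely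
  be avoided up to time \<open>N\<close>.
\<close>

lemma irreducible_underI:
  fixes P :: "'e::finite \<Rightarrow> 'a::finite \<Rightarrow> 'b::finite \<Rightarrow> 'e pmf"
  assumes less: "\<And>i j. avoid_prob P \<pi> \<sigma> j N 0 ([], i) < 1"
  shows "irreducible_under P \<pi> \<sigma>"
  unfolding irreducible_under_def
proof (intro allI)
  fix i j
  let ?M = "game_measure P i \<pi> \<sigma>"
  have S: "sets ?M = sets (\<Pi>\<^sub>M n \<in> UNIV. count_space UNIV)" and pM: "prob_space ?M"
    using is_game_measure_game_measure[of P i \<pi> \<sigma>] by (simp_all add: is_game_measure_def)
  interpret prob_space ?M by (fact pM)
  have sp: "space ?M = UNIV" by (rule space_traj[OF S])
  have meas: "{\<omega>. state_at n \<omega> = j} \<in> sets ?M" for n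
    by (rule sets_finitely_determined[OF S, where m="Suc n"]) (simp add: state_at_def)
  show "\<exists>n\<ge>1. \<P>(\<omega> in ?M. state_at n \<omega> = j) > 0"
  proof (rule ccontr)
    assume "\<not> ?thesis"
    then have zero: "prob {\<omega>. state_at n \<omega> = j} = 0" if "n \<ge> 1" for n
      using that by (auto simp: sp zero_less_measure_iff)
    have "AE \<omega> in ?M. \<forall>n\<in>{0<..0 + N}. state_at n \<omega> \<noteq> j"
    proof (intro AE_finite_allI)
      fix n assume "n \<in> {0<..0 + N}"
      then show "AE \<omega> in ?M. state_at n \<omega> \<noteq> j"
        using zero[of n] meas[of n] prob_eq_0[of "{\<omega>. state_at n \<omega> = j}"] by simp
    qed simp
    then have "prob {\<omega>. avoids j 0 N \<omega>} = 1"
      by (subst prob_eq_1[OF sets_avoids[OF S]]) (simp add: avoids_def)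
    then show False
      using less[of j i] by (simp add: prob_avoids)
  qed
qed

lemma irreducibility_condition_iff_game_V:
  fixes A :: "'e::finite \<Rightarrow> 'a::finite set" and B :: "'e \<Rightarrow> 'b::finite set"
  assumes ne: "\<And>i. A i \<noteq> {}" "\<And>i. B i \<noteq> {}"
  shows "irreducibility_condition A B P \<longleftrightarrow> (\<forall>i j. game_V A B P j CARD('e) i < 1)"
proof
  assume less: "\<forall>i j. game_V A B P j CARD('e) i < 1"
  show "irreducibility_condition A B P"
    unfolding irreducibility_condition_def
  proof (intro ballI irreducible_underI)
    fix \<pi> \<sigma> i j
    assume "\<pi> \<in> stationary_policies A B A" "\<sigma> \<in> stationary_policies A B B"
    then have "avoid_prob P \<pi> \<sigma> j CARD('e) 0 ([], i) \<le> game_V A B P j CARD('e) i"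
      using avoid_prob_le_game_V[where \<pi>=\<pi> and \<sigma>=\<sigma> and h="([], i)" and n=0
          and A=A and B=B and P=P and j=j and k="CARD('e)"]
      by (simp add: stationary_policies_def histories_def)
    also have "\<dots> < 1"
      using less by simp
    finally show "avoid_prob P \<pi> \<sigma> j CARD('e) 0 ([], i) < 1" .
  qed
next
  assume irr: "irreducibility_condition A B P"
  show "\<forall>i j. game_V A B P j CARD('e) i < 1"
  proof (rule ccontr)
    assume "\<not> ?thesis"
    then obtain i j where ij: "game_V A B P j CARD('e) i = 1"
      using game_V_le_1[where A=A and B=B and P=P, OF ne] by (meson antisym not_le)
    define S where "S = {i. game_V A B P j CARD('e) i = 1}"
    have "can_stay A B P j S = S"
      unfolding S_def by (rule game_V_eq_1_fixpoint[OF ne])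
    then have "\<exists>a b. a \<in> A x \<and> b \<in> B x \<and> (x \<in> S \<longrightarrow> set_pmf (P x a b) \<subseteq> S - {j})" for x
      using ne[of x] unfolding can_stay_def by blast
    then obtain f g where fg: "\<And>x. f x \<in> A x" "\<And>x. g x \<in> B x"
      "\<And>x. x \<in> S \<Longrightarrow> set_pmf (P x (f x) (g x)) \<subseteq> S - {j}"
      by metis
    let ?\<pi> = "\<lambda>n h. return_pmf (f (snd h))" and ?\<sigma> = "\<lambda>n h. return_pmf (g (snd h))"
    have "?\<pi> \<in> stationary_policies A B A" "?\<sigma> \<in> stationary_policies A B B"
      using fg(1,2) by (auto simp: stationary_policies_def policies_iff)
    then have "irreducible_under P ?\<pi> ?\<sigma>"
      using irr by (auto simp: irreducibility_condition_def)
    then obtain k where "avoid_prob P ?\<pi> ?\<sigma> j k 0 ([], i) < 1"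
      by (rule irreducible_under_imp_avoid_prob_less_1)
    moreover have "avoid_prob P ?\<pi> ?\<sigma> j k 0 ([], i) = 1"
      using fg(3) ij by (intro avoid_prob_invariant_set[of S]) (auto simp: S_def)
    ultimately show False
      by simp
  qed
qed

theorem proposition3p2:
  fixes A :: "'e::finite \<Rightarrow> 'a::finite set"
    and B :: "'e \<Rightarrow> 'b::finite set"
    and P :: "'e \<Rightarrow> 'a \<Rightarrow> 'b \<Rightarrow> 'e pmf"
  assumes "\<And>i. A i \<noteq> {}"
    and "\<And>i. B i \<noteq> {}"
  shows "game_gamma A B P = 1 - (MAX (i, j) \<in> UNIV. game_V A B P j CARD('e) i)
    \<and> (irreducibility_condition A B P \<longleftrightarrow> game_gamma A B P > 0)"
proof
  show gamma: "game_gamma A B P = 1 - (MAX (i, j) \<in> UNIV. game_V A B P j CARD('e) i)"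
    by (rule game_gamma_eq[OF assms])
  have "game_gamma A B P > 0 \<longleftrightarrow> (MAX (i, j) \<in> UNIV. game_V A B P j CARD('e) i) < 1"
    using gamma by simp
  also have "\<dots> \<longleftrightarrow> (\<forall>i j. game_V A B P j CARD('e) i < 1)"
    by (subst Max_less_iff) auto
  finally show "irreducibility_condition A B P \<longleftrightarrow> game_gamma A B P > 0"
    using irreducibility_condition_iff_game_V[OF assms] by simp
qed

end
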